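(* Let $\sigma\in\overline{K}_c$ be an arbitrary solution of the equation $z^{q-1}=-x$. Then the power series $$E(t)=\sigma t+\sum_{n=1}^\infty\left(\frac{\sigma^{q^n}}{D_n}-\frac{\sigma^{q^{n-1}}}{D_{n-1}}\right)t^{q^n}$$ converges for all $t\in\overline{K}_c$ with $|t|<\rho$, where $\rho=q^{\frac{q-1}{q^2}}>1$. In particular, $E(1)=\lim_{n\to\infty}\frac{\sigma^{q^n}}{D_n}$ is defined, and $E(1)=\sigma$.
   Context: Let $\mathbb F_q$ be a finite field with $q$ elements and let $K=\mathbb F_q((x))$ be the field of formal Laurent series $z=\sum_{i=n}^\infty \zeta_i x^i$, $n\in\mathbb Z$, $\zeta_i\in\mathbb F_q$, with the non-Archimedean absolute value $|z|=q^{-n}$ if $\zeta_n\neq 0$ (so $|x|=q^{-1}$). Let $\overline{K}_c$ be the completion of an algebraic closure $\overline K$ of $K$; the extension of the absolute value to $\overline{K}_c$ is also denoted $|\cdot|$. For $n\ge 1$ put $[n]=x^{q^n}-x$. The Carlitz factorial is $D_0=1$ and $D_n=[n][n-1]^q\cdots[1]^{q^{n-1}}$ for $n\ge 1$. The Carlitz exponential is $e_C(t)=\sum_{n=0}^\infty \frac{t^{q^n}}{D_n}$, which converges for $|t|<q^{-\frac1{q-1}}$. The function $E$ (the Dwork-Carlitz exponential) is initially defined by $E(t)=e_C(\sigma(t-t^q))$ for $|t|<q^{-\frac{1}{q-1}}$, where it coincides with the sum of the power series given in the claim; for other values of $t$, $E(t)$ means the sum of that power series, wherever it converges. *)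

theory Defs
  imports
    "HOL-Analysis.Analysis"
    "HOL-Computational_Algebra.Formal_Laurent_Series"
    "HOL-Algebra.Algebraic_Closure_Type"
begin

(* The constant norm is unavailable here: its type is constrained to real_normed_vector, which
   excludes positive characteristic. The absolute value is therefore a separate class parameter,
   and it induces the metric. *)
class nonarch_valued_field = field + metric_space +
  fixes absv :: "'a \<Rightarrow> real"
  assumes dist_eq_absv: "dist x y = absv (x - y)"
    and absv_mult: "absv (x * y) = absv x * absv y"
    and absv_add_le_max: "absv (x + y) \<le> max (absv x) (absv y)"

(* The metric that the library puts on 'a fls has base 2; the base required here is
   q = CARD('a). *)
definition laurent_abs :: "'a::{field,finite} fls \<Rightarrow> real" where
  "laurent_abs z =
     (if z = 0 then 0 else real CARD('a) powr (- real_of_int (fls_subdegree z)))"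

(* \<iota> exhibits the complete field 'c as the completion of the algebraic closure of
   K = F_q((x)): it is a dense field embedding, and the absolute value of 'c restricts to that
   of K. *)
definition is_alg_closure_completion ::
  "('a::{field,finite} fls alg_closure \<Rightarrow> 'c::{nonarch_valued_field,complete_space}) \<Rightarrow> bool" where
  "is_alg_closure_completion \<iota> \<longleftrightarrow>
     \<iota> 1 = 1 \<and>
     (\<forall>a b. \<iota> (a + b) = \<iota> a + \<iota> b) \<and>
     (\<forall>a b. \<iota> (a * b) = \<iota> a * \<iota> b) \<and>
     (\<forall>z. absv (\<iota> (to_ac z)) = laurent_abs z) \<and>
     closure (range \<iota>) = UNIV"

definition carlitz_bracket :: "nat \<Rightarrow> 'a::{field,finite} fls" where
  "carlitz_bracket n = fls_X ^ (CARD('a) ^ n) - fls_X"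

definition carlitz_factorial :: "nat \<Rightarrow> 'a::{field,finite} fls" where
  "carlitz_factorial n = (\<Prod>i=1..n. carlitz_bracket i ^ (CARD('a) ^ (n - i)))"

definition carlitz_exp ::
  "('a::{field,finite} fls alg_closure \<Rightarrow> 'c::{nonarch_valued_field,complete_space}) \<Rightarrow> 'c \<Rightarrow> 'c" where
  "carlitz_exp \<iota> t = (\<Sum>n. t ^ (CARD('a) ^ n) / \<iota> (to_ac (carlitz_factorial n)))"

(* The coefficient of t ^ (q ^ n); all other coefficients of the power series vanish. *)
definition dwork_carlitz_coeff ::
  "('a::{field,finite} fls alg_closure \<Rightarrow> 'c::{nonarch_valued_field,complete_space}) \<Rightarrow> 'c \<Rightarrow> nat \<Rightarrow> 'c" where
  "dwork_carlitz_coeff \<iota> \<sigma> n =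
     (if n = 0 then \<sigma>
      else \<sigma> ^ (CARD('a) ^ n) / \<iota> (to_ac (carlitz_factorial n))
         - \<sigma> ^ (CARD('a) ^ (n - 1)) / \<iota> (to_ac (carlitz_factorial (n - 1))))"

definition dwork_carlitz_exp ::
  "('a::{field,finite} fls alg_closure \<Rightarrow> 'c::{nonarch_valued_field,complete_space}) \<Rightarrow> 'c \<Rightarrow> 'c \<Rightarrow> 'c" where
  "dwork_carlitz_exp \<iota> \<sigma> t =
     (if absv t < real CARD('a) powr (- 1 / (real CARD('a) - 1))
      then carlitz_exp \<iota> (\<sigma> * (t - t ^ CARD('a)))
      else (\<Sum>n. dwork_carlitz_coeff \<iota> \<sigma> n * t ^ (CARD('a) ^ n)))"

end

theory Submission
  imports Defs
begin

text \<open>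
  Write \<open>\<xi>\<close> for the image of \<open>x\<close> in the completion and \<open>u n = \<sigma>^(q^n) / D n\<close>, so that the series
  under study has the coefficients \<open>u 0\<close> and \<open>u n - u (n - 1)\<close>. The factorials obey
  \<open>D (n + 1) = [n + 1] * (D n)^q\<close>, and \<open>\<sigma>^(q - 1) = - \<xi>\<close> cancels the factor \<open>- \<xi>\<close> of
  \<open>[n + 1] = - \<xi> * (1 - \<xi>^(q^(n + 1) - 1))\<close>. Hence the ratios \<open>b n = u n / \<sigma>\<close> satisfy
  \<open>b 0 = 1\<close> and \<open>b (n + 1) = (b n)^q / (1 - \<xi>^(q^(n + 1) - 1))\<close>.

  The map \<open>y \<mapsto> y^q\<close> is additive (\<open>finite_field_card_choose_eq_0\<close>), so it takes an error \<open>b n - 1\<close> to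
  \<open>(b n - 1)^q\<close>. The denominator adds \<open>\<xi>^(q^(n + 1) - 1)\<close> to this, which creates the first error,
  at \<open>b 1\<close>, and is never
  larger than \<open>(\<bar>\<xi>\<bar>^(q - 1))^(q^n)\<close>, the bound for that one raised to the power \<open>q^n\<close>. This gives
  \<open>\<bar>b (n + 1) - 1\<bar> \<le> (\<bar>\<xi>\<bar>^(q - 1))^(q^n)\<close> (\<open>frobenius_recursion_close_to_1\<close>), and with it both
  claims. First, \<open>u n\<close> tends to \<open>\<sigma>\<close>; since the partial sums of the series at \<open>t = 1\<close> telescope to
  \<open>u n\<close>, this is the value at \<open>1\<close>. Secondly, the term of index \<open>n + 2\<close> at \<open>t\<close> is bounded by
  \<open>\<bar>\<sigma>\<bar> * (\<bar>\<xi>\<bar>^(q - 1) * \<bar>t\<bar>^(q^2))^(q^n)\<close>, which tends to \<open>0\<close> exactly when \<open>\<bar>t\<bar> < \<rho>\<close>; in a complete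
  non-Archimedean field this is all that convergence requires.

  For small \<open>t\<close> the function is defined as the Carlitz exponential at \<open>\<sigma> * (t - t^q)\<close>. Additivity
  of the \<open>q\<close>-th power and summation by parts show that its partial sums differ from those of the
  power series by \<open>u N * t^(q^N)\<close>, which tends to \<open>0\<close> for \<open>\<bar>t\<bar> < 1\<close>.
\<close>

section \<open>Additivity of the q-th power\<close>

lemma finite_field_power_card:
  fixes a :: "'a::{field,finite}"
  shows "a ^ CARD('a) = a"
proof (cases "a = 0")
  case True
  then show ?thesis by (simp add: power_0_left)
next
  case False
  let ?U = "UNIV - {0} :: 'a set"
  have "bij_betw ((*) a) ?U ?U"
    by (rule bij_betw_byWitness[where f' = "\<lambda>y. y / a"]) (use False in auto)
  then have "(\<Prod>y\<in>?U. a * y) = \<Prod>?U"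
    using prod.reindex_bij_betw[of "(*) a" ?U ?U "\<lambda>y. y"] by simp
  then have "a ^ card ?U = 1"
    by (simp add: prod.distrib)
  moreover have "CARD('a) = Suc (card ?U)"
    using card_Suc_Diff1[of "UNIV :: 'a set" 0] by simp
  ultimately show ?thesis
    by (simp only: power_Suc mult_1_right)
qed

lemma power_add_split_ends:
  fixes x y :: "'c::comm_ring_1"
  assumes "n > 0"
  shows "(x + y) ^ n = x ^ n + y ^ n + (\<Sum>i\<in>{0<..<n}. of_nat (n choose i) * x ^ i * y ^ (n - i))"
proof -
  have "{..n} = insert 0 (insert n {0<..<n})"
    using assms by auto
  then show ?thesis
    using assms by (simp add: binomial_ring add_ac)
qed

text \<open>
  The polynomial \<open>(Y + 1)^q - Y^q - 1\<close> has degree less than \<open>q\<close>, and it vanishes at all \<open>q\<close> elements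
  of the field because \<open>a^q = a\<close>. So it is zero, and its coefficients are the inner binomial
  coefficients.
\<close>
lemma finite_field_card_choose_eq_0:
  assumes "0 < i" "i < CARD('a::{field,finite})"
  shows "of_nat (CARD('a) choose i) = (0::'a)"
proof -
  let ?q = "CARD('a)"
  define P :: "'a poly" where "P = (\<Sum>i\<in>{0<..<?q}. Polynomial.monom (of_nat (?q choose i)) i)"
  have deg: "Polynomial.degree P < ?q"
    unfolding P_def
    by (rule degree_sum_less) (auto intro: le_less_trans[OF Polynomial.degree_monom_le])
  have roots: "poly P a = 0" for a
  proof -
    have "(a + 1) ^ ?q = a ^ ?q + 1 ^ ?q + poly P a"
      by (subst power_add_split_ends) (simp_all add: P_def poly_sum Polynomial.poly_monom)
    then show ?thesis
      unfolding finite_field_power_card by simp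
  qed
  have "P = 0"
    by (rule poly_eqI_degree[where A = UNIV]) (use deg roots in auto)
  moreover have "poly.coeff P i = of_nat (?q choose i)"
    using assms by (simp add: P_def Polynomial.coeff_sum)
  ultimately show ?thesis by simp
qed

lemma power_power_Suc:
  fixes x :: "'c::monoid_mult"
  shows "x ^ (q ^ Suc k) = (x ^ (q ^ k)) ^ q"
  by (simp only: power_Suc2 power_mult)

lemma additive_power_iterate:
  fixes x y :: "'c::comm_ring_1"
  assumes frob: "\<And>u v :: 'c. (u + v) ^ q = u ^ q + v ^ q"
  shows "(x - y) ^ (q ^ k) = x ^ (q ^ k) - y ^ (q ^ k)"
proof (induction k)
  case 0
  then show ?case by simp
next
  case (Suc k)
  have diff: "(u - v) ^ q = u ^ q - v ^ q" for u v :: 'c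
    using frob[of "u - v" v] by (simp add: algebra_simps)
  show ?case
    by (simp only: power_power_Suc Suc diff)
qed

section \<open>Non-Archimedean valued fields\<close>

context nonarch_valued_field
begin

lemma absv_nonneg [simp]: "absv x \<ge> 0"
  using dist_eq_absv[of x 0] zero_le_dist[of x 0] by simp

lemma absv_eq_0_iff [simp]: "absv x = 0 \<longleftrightarrow> x = 0"
  using dist_eq_absv[of x 0] dist_eq_0_iff[of x 0] by simp

lemma absv_0 [simp]: "absv 0 = 0"
  by simp

lemma absv_1 [simp]: "absv 1 = 1"
  using absv_mult[of 1 1] absv_eq_0_iff[of 1] by simp

lemma absv_minus [simp]: "absv (- x) = absv x"
  using dist_commute[of x 0] by (simp add: dist_eq_absv)

lemma absv_power: "absv (x ^ n) = absv x ^ n"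
  by (induction n) (simp_all add: absv_mult)

lemma absv_divide: "absv (x / y) = absv x / absv y"
proof (cases "y = 0")
  case True
  then show ?thesis by simp
next
  case False
  then show ?thesis
    using absv_mult[of "x / y" y] by (simp add: field_simps)
qed

lemma absv_diff_le_max: "absv (x - y) \<le> max (absv x) (absv y)"
  using absv_add_le_max[of x "- y"] by simp

lemma absv_1_minus: "absv z < 1 \<Longrightarrow> absv (1 - z) = 1"
  using absv_diff_le_max[of 1 z] absv_add_le_max[of "1 - z" z]
  by (simp only: diff_add_cancel absv_1)

lemma absv_sum_less:
  assumes "e > 0" "\<And>i. i \<in> A \<Longrightarrow> absv (f i) < e"
  shows "absv (sum f A) < e"
  using assms
proof (induction A rule: infinite_finite_induct)
  case (insert a A)
  then have "absv (f a) < e" "absv (sum f A) < e"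
    by auto
  then show ?case
    using absv_add_le_max[of "f a" "sum f A"] insert.hyps by simp
qed auto

end

text \<open>
  By the ultrametric inequality a block of consecutive terms is no larger than its largest term,
  so null terms already make the partial sums a Cauchy sequence.
\<close>
lemma nonarch_summable:
  fixes f :: "nat \<Rightarrow> 'c::{nonarch_valued_field,complete_space}"
  assumes "(\<lambda>n. absv (f n)) \<longlonglongrightarrow> 0"
  shows "summable f"
proof -
  have "Cauchy (\<lambda>n. \<Sum>i<n. f i)"
  proof (rule CauchyI')
    fix e :: real
    assume "e > 0"
    then obtain M where M: "\<And>n. n \<ge> M \<Longrightarrow> absv (f n) < e"
      using order_tendstoD(2)[OF assms] by (auto simp: eventually_sequentially)
    have "dist (\<Sum>i<m. f i) (\<Sum>i<n. f i) < e" if "m \<ge> M" "n > m" for m n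
    proof -
      have "(\<Sum>i<n. f i) - (\<Sum>i<m. f i) = sum f {m..<n}"
        using that by (simp add: sum_diff_nat_ivl lessThan_atLeast0)
      moreover have "absv (sum f {m..<n}) < e"
        using \<open>e > 0\<close> M that by (intro absv_sum_less) auto
      ultimately show ?thesis
        by (subst dist_commute) (simp add: dist_eq_absv)
    qed
    then show "\<exists>M. \<forall>m\<ge>M. \<forall>n>m. dist (\<Sum>i<m. f i) (\<Sum>i<n. f i) < e"
      by blast
  qed
  then show ?thesis
    by (simp add: Cauchy_convergent_iff convergent_def summable_def sums_def)
qed

lemma tendsto_0_nonneg_le:
  fixes f g :: "nat \<Rightarrow> real"
  assumes "\<And>n. 0 \<le> f n" "\<And>n. f n \<le> g n" "g \<longlonglongrightarrow> 0"
  shows "f \<longlonglongrightarrow> 0"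
  by (rule tendsto_sandwich[OF _ _ tendsto_const assms(3)]) (use assms(1,2) in simp_all)

lemma nonarch_tendsto_iff:
  fixes f :: "nat \<Rightarrow> 'c::nonarch_valued_field"
  shows "f \<longlonglongrightarrow> L \<longleftrightarrow> (\<lambda>n. absv (f n - L)) \<longlonglongrightarrow> 0"
  by (subst tendsto_dist_iff) (simp add: dist_eq_absv)

lemma nonarch_tendsto_perturb:
  fixes f g :: "nat \<Rightarrow> 'c::nonarch_valued_field"
  assumes "f \<longlonglongrightarrow> L" "(\<lambda>n. absv (g n - f n)) \<longlonglongrightarrow> 0"
  shows "g \<longlonglongrightarrow> L"
proof -
  have lim: "(\<lambda>n. max (absv (g n - f n)) (absv (f n - L))) \<longlonglongrightarrow> max 0 0"
    using assms by (intro tendsto_max) (simp_all add: nonarch_tendsto_iff)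
  have "absv (g n - L) \<le> max (absv (g n - f n)) (absv (f n - L))" for n
    using absv_add_le_max[of "g n - f n" "f n - L"] by simp
  from tendsto_0_nonneg_le[OF absv_nonneg this lim [unfolded max.idem]] show ?thesis
    by (simp only: nonarch_tendsto_iff)
qed

lemma power_power_tendsto_0:
  fixes r :: real
  assumes "0 \<le> r" "r < 1" "q \<ge> 2"
  shows "(\<lambda>n. r ^ (q ^ n)) \<longlonglongrightarrow> 0"
proof (rule tendsto_sandwich[OF _ _ tendsto_const LIMSEQ_power_zero])
  have "n \<le> q ^ n" for n
    using less_exp[of n] power_mono[of 2 q n] assms by linarith
  then show "\<forall>\<^sub>F n in sequentially. r ^ (q ^ n) \<le> r ^ n"
    using assms by (intro always_eventually allI power_decreasing) auto
qed (use assms in auto)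

section \<open>The recursion for the normalised coefficients\<close>

text \<open>
  From \<open>b (n + 1) - 1 = ((b n - 1)^q + \<xi>^(q^(n + 1) - 1)) / (1 - \<xi>^(q^(n + 1) - 1))\<close>: the denominator
  is a unit, the first summand inherits the bound from the previous step, and the second one obeys
  it because \<open>q^(n + 1) - 1 \<ge> (q - 1) * q^n\<close>.
\<close>
lemma frobenius_recursion_close_to_1:
  fixes b :: "nat \<Rightarrow> 'c::nonarch_valued_field"
  assumes frob: "\<And>u v :: 'c. (u + v) ^ q = u ^ q + v ^ q"
    and q: "q \<ge> 2" and \<xi>: "absv \<xi> < 1"
    and b0: "b 0 = 1"
    and b_Suc: "\<And>n. b (Suc n) = b n ^ q / (1 - \<xi> ^ (q ^ Suc n - 1))"
  shows "absv (b (Suc n) - 1) \<le> (absv \<xi> ^ (q - 1)) ^ (q ^ n)"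
proof -
  have step: "absv (b (Suc n) - 1) \<le> max (absv (b n - 1) ^ q) ((absv \<xi> ^ (q - 1)) ^ (q ^ n))" for n
  proof -
    let ?z = "\<xi> ^ (q ^ Suc n - 1)"
    have exp: "(q - 1) * q ^ n \<le> q ^ Suc n - 1"
      using q by (simp add: diff_mult_distrib diff_le_mono2)
    have "(q - 1) * q ^ n > 0"
      using q by simp
    then have "q ^ Suc n - 1 > 0"
      using exp by linarith
    then have unit: "absv (1 - ?z) = 1"
      using \<xi> by (intro absv_1_minus) (simp add: absv_power power_less_one_iff)
    then have "1 - ?z \<noteq> 0"
      using absv_eq_0_iff[of "1 - ?z"] by linarith
    moreover have "(b n - 1) ^ q = b n ^ q - 1"
      using frob[of "b n - 1" 1] by simp
    ultimately have "b (Suc n) - 1 = ((b n - 1) ^ q + ?z) / (1 - ?z)"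
      by (simp add: b_Suc field_simps)
    then have "absv (b (Suc n) - 1) \<le> max (absv (b n - 1) ^ q) (absv \<xi> ^ (q ^ Suc n - 1))"
      using absv_add_le_max[of "(b n - 1) ^ q" ?z] unit by (simp add: absv_divide absv_power)
    moreover have "absv \<xi> ^ (q ^ Suc n - 1) \<le> (absv \<xi> ^ (q - 1)) ^ (q ^ n)"
      using \<xi> exp by (simp add: power_mult [symmetric] power_decreasing)
    ultimately show ?thesis by linarith
  qed
  show ?thesis
  proof (induction n)
    case 0
    then show ?case
      using step[of 0] q by (simp add: b0 power_0_left)
  next
    case (Suc n)
    have "absv (b (Suc n) - 1) ^ q \<le> ((absv \<xi> ^ (q - 1)) ^ (q ^ n)) ^ q"
      using Suc by (intro power_mono) auto
    also have "\<dots> = (absv \<xi> ^ (q - 1)) ^ (q ^ Suc n)"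
      by (simp only: power_power_Suc)
    finally show ?case
      using step[of "Suc n"] by linarith
  qed
qed

lemma carlitz_factorial_0 [simp]: "carlitz_factorial 0 = 1"
  by (simp add: carlitz_factorial_def)

lemma carlitz_factorial_Suc:
  "carlitz_factorial (Suc n) =
     (carlitz_bracket (Suc n) * carlitz_factorial n ^ CARD('a) :: 'a::{field,finite} fls)"
proof -
  have "(\<Prod>i=1..n. carlitz_bracket i ^ (CARD('a) ^ (Suc n - i))) =
      (\<Prod>i=1..n. (carlitz_bracket i ^ (CARD('a) ^ (n - i)) :: 'a fls) ^ CARD('a))"
    by (intro prod.cong refl) (simp add: Suc_diff_le power_mult [symmetric] mult.commute)
  then show ?thesis
    by (simp add: carlitz_factorial_def prod_power_distrib mult.commute)
qed

section \<open>Convergence and the value at 1\<close>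

text \<open>
  The analytic content, for any complete non-Archimedean field in which the \<open>q\<close>-th power is
  additive: \<open>u\<close> stands for the sequence \<open>\<sigma>^(q^n) / D n\<close>.
\<close>
lemma carlitz_recursion_limits:
  fixes u :: "nat \<Rightarrow> 'c::{nonarch_valued_field,complete_space}"
  assumes frob: "\<And>u v :: 'c. (u + v) ^ q = u ^ q + v ^ q"
    and q: "q \<ge> 2" and \<xi>: "absv \<xi> < 1" "\<xi> \<noteq> 0"
    and \<sigma>: "\<sigma> ^ (q - 1) = - \<xi>"
    and u0: "u 0 = \<sigma>"
    and u_Suc: "\<And>n. u (Suc n) = u n ^ q / (\<xi> ^ (q ^ Suc n) - \<xi>)"
  shows "u \<longlonglongrightarrow> \<sigma>"
    and "absv \<xi> ^ (q - 1) * absv t ^ (q ^ 2) < 1 \<Longrightarrow>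
      summable (\<lambda>n. (if n = 0 then \<sigma> else u n - u (n - 1)) * t ^ (q ^ n))"
proof -
  define y where "y = absv \<xi> ^ (q - 1)"
  define b where "b n = u n / \<sigma>" for n
  have \<sigma>0: "\<sigma> \<noteq> 0"
    using \<sigma> \<xi> q by (auto simp: power_0_left)
  have u_b: "u n = \<sigma> * b n" for n
    using \<sigma>0 by (simp add: b_def)
  have \<sigma>q: "\<sigma> ^ q = - \<xi> * \<sigma>"
    using \<sigma> q power_Suc2[of \<sigma> "q - 1"] by simp
  have b_Suc: "b (Suc n) = b n ^ q / (1 - \<xi> ^ (q ^ Suc n - 1))" for n
  proof -
    have "\<xi> ^ (q ^ Suc n) = \<xi> * \<xi> ^ (q ^ Suc n - 1)"
      using q by (subst power_Suc [symmetric]) simp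
    then have "u (Suc n) = (- \<xi> * \<sigma> * b n ^ q) / (- \<xi> * (1 - \<xi> ^ (q ^ Suc n - 1)))"
      by (simp only: u_Suc u_b[of n] power_mult_distrib \<sigma>q)
        (simp add: right_diff_distrib minus_divide_right)
    also have "\<dots> = \<sigma> * (b n ^ q / (1 - \<xi> ^ (q ^ Suc n - 1)))"
      using \<xi> by (simp add: mult.assoc)
    finally show ?thesis
      using \<sigma>0 by (simp add: b_def)
  qed
  have y: "0 \<le> y" "y < 1"
    using \<xi> q by (auto simp: y_def power_less_one_iff)
  \<comment> \<open>A difference \<open>u n - u (n - 1)\<close> involves \<open>b (n - 1)\<close>, so this bound controls it from \<open>n = 2\<close> on; hence
     the shift by two in the convergence argument.\<close>
  have close: "absv (b (Suc n) - 1) \<le> y ^ (q ^ n)" for n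
    unfolding y_def
    by (rule frobenius_recursion_close_to_1[OF frob q \<xi>(1)]) (use u0 \<sigma>0 b_Suc b_def in auto)

  show "u \<longlonglongrightarrow> \<sigma>"
  proof (subst filterlim_sequentially_Suc [symmetric], subst nonarch_tendsto_iff)
    have eq: "absv (u (Suc n) - \<sigma>) = absv \<sigma> * absv (b (Suc n) - 1)" for n
      by (simp add: u_b absv_mult [symmetric] algebra_simps)
    have lim: "(\<lambda>n. absv \<sigma> * y ^ (q ^ n)) \<longlonglongrightarrow> absv \<sigma> * 0"
      using y q by (intro tendsto_mult tendsto_const power_power_tendsto_0) auto
    show "(\<lambda>n. absv (u (Suc n) - \<sigma>)) \<longlonglongrightarrow> 0"
      by (rule tendsto_0_nonneg_le[OF _ _ lim [unfolded mult_zero_right]])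
        (auto simp: eq intro!: mult_left_mono close)
  qed

  assume t: "absv \<xi> ^ (q - 1) * absv t ^ (q ^ 2) < 1"
  have bound: "absv ((u (Suc (Suc n)) - u (Suc n)) * t ^ (q ^ Suc (Suc n)))
      \<le> absv \<sigma> * (y * absv t ^ (q ^ 2)) ^ (q ^ n)" for n
  proof -
    have "y ^ (q ^ Suc n) \<le> y ^ (q ^ n)"
      using y q by (intro power_decreasing power_increasing) auto
    then have "absv (b (Suc (Suc n)) - b (Suc n)) \<le> y ^ (q ^ n)"
      using absv_diff_le_max[of "b (Suc (Suc n)) - 1" "b (Suc n) - 1"] close[of n] close[of "Suc n"]
      by simp
    moreover have "absv ((u (Suc (Suc n)) - u (Suc n)) * t ^ (q ^ Suc (Suc n)))
        = absv \<sigma> * (absv (b (Suc (Suc n)) - b (Suc n)) * (absv t ^ (q ^ 2)) ^ (q ^ n))"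
      by (simp add: u_b right_diff_distrib [symmetric] absv_mult absv_power power_mult [symmetric]
          power2_eq_square mult.assoc)
    ultimately show ?thesis
      by (simp add: power_mult_distrib mult_left_mono mult_right_mono)
  qed
  have lim: "(\<lambda>n. absv \<sigma> * (y * absv t ^ (q ^ 2)) ^ (q ^ n)) \<longlonglongrightarrow> absv \<sigma> * 0"
    using y q t by (intro tendsto_mult tendsto_const power_power_tendsto_0) (auto simp: y_def)
  define f where "f n = (if n = 0 then \<sigma> else u n - u (n - 1)) * t ^ (q ^ n)" for n
  have "(\<lambda>n. absv (f (Suc (Suc n)))) \<longlonglongrightarrow> 0"
    by (rule tendsto_0_nonneg_le[OF _ _ lim [unfolded mult_zero_right]])
      (use bound in \<open>simp_all add: f_def\<close>)
  then have "(\<lambda>n. absv (f n)) \<longlonglongrightarrow> 0"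
    using filterlim_sequentially_Suc[of "\<lambda>n. absv (f (Suc n))"]
      filterlim_sequentially_Suc[of "\<lambda>n. absv (f n)"] by simp
  then show "summable (\<lambda>n. (if n = 0 then \<sigma> else u n - u (n - 1)) * t ^ (q ^ n))"
    using nonarch_summable[of f] by (simp add: f_def[abs_def])
qed

text \<open>
  Summation by parts: each \<open>u n\<close> occurs with \<open>t^(q^n)\<close> and, one index later, with \<open>- t^(q^(n + 1))\<close>,
  which together give \<open>u n * (t - t^q)^(q^n)\<close>.
\<close>
lemma partial_sums_shift:
  fixes u :: "nat \<Rightarrow> 'c::comm_ring_1"
  assumes frob: "\<And>u v :: 'c. (u + v) ^ q = u ^ q + v ^ q"
  shows "(\<Sum>n<Suc N. (if n = 0 then u 0 else u n - u (n - 1)) * t ^ (q ^ n)) =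
    (\<Sum>n<N. u n * (t - t ^ q) ^ (q ^ n)) + u N * t ^ (q ^ N)"
proof (induction N)
  case 0
  then show ?case by simp
next
  case (Suc N)
  have "(t - t ^ q) ^ (q ^ N) = t ^ (q ^ N) - t ^ (q ^ Suc N)"
    by (simp add: additive_power_iterate[OF frob] power_mult [symmetric])
  then have "u N * (t - t ^ q) ^ (q ^ N) = u N * t ^ (q ^ N) - u N * t ^ (q ^ Suc N)"
    by (simp only: right_diff_distrib)
  then have rhs: "(\<Sum>n<Suc N. u n * (t - t ^ q) ^ (q ^ n)) =
      (\<Sum>n<N. u n * (t - t ^ q) ^ (q ^ n)) + u N * t ^ (q ^ N) - u N * t ^ (q ^ Suc N)"
    by (simp only: sum.lessThan_Suc add_diff_eq)
  have "(\<Sum>n<Suc (Suc N). (if n = 0 then u 0 else u n - u (n - 1)) * t ^ (q ^ n)) =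
      (\<Sum>n<Suc N. (if n = 0 then u 0 else u n - u (n - 1)) * t ^ (q ^ n))
      + (u (Suc N) * t ^ (q ^ Suc N) - u N * t ^ (q ^ Suc N))"
    by (subst sum.lessThan_Suc) (simp only: left_diff_distrib diff_Suc_1 nat.distinct if_False)
  then show ?case
    unfolding Suc rhs by simp
qed

theorem proposition2:
  fixes \<iota> :: "'a::{field,finite} fls alg_closure \<Rightarrow> 'c::{nonarch_valued_field,complete_space}"
    and \<sigma> :: 'c and q :: nat and \<rho> :: real
  assumes "q = CARD('a)"
    and "is_alg_closure_completion \<iota>"
    and "\<sigma> ^ (q - 1) = - \<iota> (to_ac fls_X)"
    and "\<rho> = real q powr ((real q - 1) / (real q)\<^sup>2)"
  shows "\<rho> > 1 \<and>
    (\<forall>t. absv t < \<rho> \<longrightarrow>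
       (\<lambda>n. dwork_carlitz_coeff \<iota> \<sigma> n * t ^ (q ^ n)) sums dwork_carlitz_exp \<iota> \<sigma> t) \<and>
    (\<lambda>n. \<sigma> ^ (q ^ n) / \<iota> (to_ac (carlitz_factorial n))) \<longlonglongrightarrow> dwork_carlitz_exp \<iota> \<sigma> 1 \<and>
    dwork_carlitz_exp \<iota> \<sigma> 1 = \<sigma>"
proof -
  define \<xi> where "\<xi> = \<iota> (to_ac fls_X)"
  define u where "u n = \<sigma> ^ (q ^ n) / \<iota> (to_ac (carlitz_factorial n))" for n
  have "card {0, 1 :: 'a} \<le> CARD('a)"
    by (intro card_mono) auto
  then have q: "q \<ge> 2"
    using assms(1) by simp

  have \<iota>1: "\<iota> 1 = 1" and \<iota>_add: "\<iota> (v + w) = \<iota> v + \<iota> w" and \<iota>_mult: "\<iota> (v * w) = \<iota> v * \<iota> w"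
    and \<iota>_abs: "absv (\<iota> (to_ac z)) = laurent_abs z" for v w z
    using assms(2) by (auto simp: is_alg_closure_completion_def)
  have \<iota>0: "\<iota> 0 = 0"
    using \<iota>_add[of 0 0] by (simp only: add_0_right add_cancel_right_right)
  have \<iota>_diff: "\<iota> (v - w) = \<iota> v - \<iota> w" for v w
    using \<iota>_add[of "v - w" w] by (simp add: algebra_simps)
  have \<iota>_power: "\<iota> (v ^ n) = \<iota> v ^ n" for v n
    by (induction n) (simp_all add: \<iota>1 \<iota>_mult)
  have \<iota>_of_nat: "\<iota> (of_nat n) = of_nat n" for n
    by (induction n) (simp_all add: \<iota>0 \<iota>1 \<iota>_add)

  \<comment> \<open>The binomial coefficients vanish in the finite field, hence in every ring that receives a
     homomorphism from it.\<close>
  have frob: "(v + w) ^ q = v ^ q + w ^ q" for v w :: 'c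
  proof -
    have "of_nat (q choose i) = (0 :: 'c)" if "i \<in> {0<..<q}" for i
    proof -
      have "(of_nat (q choose i) :: 'a) = 0"
        using that finite_field_card_choose_eq_0[where 'a = 'a, of i] by (simp add: assms(1))
      then have "(of_nat (q choose i) :: 'a fls) = 0"
        by (simp add: fls_of_nat)
      then have "\<iota> (to_ac (of_nat (q choose i) :: 'a fls)) = 0"
        by (simp only: to_ac_0 \<iota>0)
      then show ?thesis
        by (simp add: \<iota>_of_nat)
    qed
    then show ?thesis
      using q by (simp add: power_add_split_ends)
  qed

  have abs_\<xi>: "absv \<xi> = 1 / real q"
    by (simp add: \<xi>_def \<iota>_abs laurent_abs_def assms(1) powr_minus_divide)
  then have \<xi>: "absv \<xi> < 1" "\<xi> \<noteq> 0"
    using q by auto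
  have u0: "u 0 = \<sigma>"
    by (simp add: u_def \<iota>1)
  have u_Suc: "u (Suc n) = u n ^ q / (\<xi> ^ (q ^ Suc n) - \<xi>)" for n
    by (simp add: u_def \<xi>_def carlitz_factorial_Suc carlitz_bracket_def assms(1) [symmetric]
        \<iota>_mult \<iota>_diff \<iota>_power power_divide power_power_Suc mult.commute del: power_Suc)
  have coeff: "dwork_carlitz_coeff \<iota> \<sigma> n = (if n = 0 then u 0 else u n - u (n - 1))" for n
    by (auto simp: dwork_carlitz_coeff_def u_def u0 assms(1) \<iota>1)
  have \<sigma>: "\<sigma> ^ (q - 1) = - \<xi>"
    using assms(3) by (simp add: \<xi>_def)
  note limits = carlitz_recursion_limits[OF frob q \<xi> \<sigma> u0 u_Suc]

  have \<rho>: "\<rho> > 1"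
    unfolding assms(4) using q by (intro gr_one_powr) auto
  have summable: "summable (\<lambda>n. dwork_carlitz_coeff \<iota> \<sigma> n * t ^ (q ^ n))" if t: "absv t < \<rho>" for t
  proof -
    \<comment> \<open>The exponent in \<open>\<rho>\<close> is chosen so that \<open>\<rho>^(q^2) = q^(q - 1) = \<bar>\<xi>\<bar>^(-(q - 1))\<close>.\<close>
    have "absv t ^ (q ^ 2) < \<rho> ^ (q ^ 2)"
      using t q by (intro power_strict_mono) auto
    also have "\<rho> ^ (q ^ 2) = real q powr (real (q ^ 2) * ((real q - 1) / (real q)\<^sup>2))"
      using q by (simp only: assms(4) powr_power)
    also have "real (q ^ 2) * ((real q - 1) / (real q)\<^sup>2) = real (q - 1)"
      using q by (simp add: of_nat_diff)
    also have "real q powr real (q - 1) = real q ^ (q - 1)"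
      using q by (simp only: powr_realpow)
    finally have "absv \<xi> ^ (q - 1) * absv t ^ (q ^ 2) < 1"
      using q by (simp add: abs_\<xi> power_divide field_simps)
    from limits(2)[OF this] show ?thesis
      by (simp add: coeff u0 cong: if_cong)
  qed

  have sums: "(\<lambda>n. dwork_carlitz_coeff \<iota> \<sigma> n * t ^ (q ^ n)) sums dwork_carlitz_exp \<iota> \<sigma> t"
    if t: "absv t < \<rho>" for t
  proof (cases "absv t < real q powr (- 1 / (real q - 1))")
    case False
    then show ?thesis
      using summable_sums[OF summable[OF t]] by (simp add: dwork_carlitz_exp_def assms(1))
  next
    case True
    let ?S = "\<Sum>n. dwork_carlitz_coeff \<iota> \<sigma> n * t ^ (q ^ n)"
    have "real q powr (- 1 / (real q - 1)) \<le> real q powr 0"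
      using q by (intro powr_mono) (auto simp: field_simps)
    then have t1: "absv t < 1"
      using True q by simp
    have "(\<lambda>N. \<Sum>n<Suc N. dwork_carlitz_coeff \<iota> \<sigma> n * t ^ (q ^ n)) \<longlonglongrightarrow> ?S"
      using summable_LIMSEQ[OF summable[OF t]] by (subst filterlim_sequentially_Suc)
    moreover have "(\<lambda>N. absv ((\<Sum>n<N. u n * (t - t ^ q) ^ (q ^ n)) -
        (\<Sum>n<Suc N. dwork_carlitz_coeff \<iota> \<sigma> n * t ^ (q ^ n)))) \<longlonglongrightarrow> 0"
    proof -
      have "absv (u N) * absv t ^ (q ^ N) = absv ((\<Sum>n<N. u n * (t - t ^ q) ^ (q ^ n)) -
          (\<Sum>n<Suc N. dwork_carlitz_coeff \<iota> \<sigma> n * t ^ (q ^ n)))" for N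
        by (simp only: coeff partial_sums_shift[OF frob]) (simp add: absv_mult absv_power)
      moreover have "(\<lambda>N. absv (u N)) \<longlonglongrightarrow> absv \<sigma>"
        using tendsto_dist[OF limits(1) tendsto_const[of 0]] by (simp add: dist_eq_absv)
      then have "(\<lambda>N. absv (u N) * absv t ^ (q ^ N)) \<longlonglongrightarrow> absv \<sigma> * 0"
        using t1 q by (intro tendsto_mult power_power_tendsto_0) auto
      ultimately show ?thesis by simp
    qed
    ultimately have "(\<lambda>N. \<Sum>n<N. u n * (t - t ^ q) ^ (q ^ n)) \<longlonglongrightarrow> ?S"
      by (rule nonarch_tendsto_perturb)
    then have "(\<lambda>n. u n * (t - t ^ q) ^ (q ^ n)) sums ?S"
      by (simp add: sums_def)
    then have "carlitz_exp \<iota> (\<sigma> * (t - t ^ q)) = ?S"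
      by (simp add: carlitz_exp_def u_def assms(1) [symmetric] power_mult_distrib sums_iff)
    then show ?thesis
      using summable_sums[OF summable[OF t]] True
      by (simp add: dwork_carlitz_exp_def assms(1) [symmetric])
  qed

  \<comment> \<open>At \<open>t = 1\<close> the summand \<open>u n * (t - t^q)^(q^n)\<close> vanishes, so the partial sums collapse to \<open>u N\<close>.\<close>
  have "u \<longlonglongrightarrow> dwork_carlitz_exp \<iota> \<sigma> 1"
  proof -
    have "(\<Sum>n<Suc N. dwork_carlitz_coeff \<iota> \<sigma> n * 1 ^ (q ^ n)) = u N" for N
      using partial_sums_shift[OF frob, where u = u and N = N and t = 1] q by (simp add: coeff power_0_left)
    moreover have "(\<lambda>N. \<Sum>n<Suc N. dwork_carlitz_coeff \<iota> \<sigma> n * 1 ^ (q ^ n))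
        \<longlonglongrightarrow> dwork_carlitz_exp \<iota> \<sigma> 1"
      using sums[of 1] \<rho> unfolding sums_def by (subst filterlim_sequentially_Suc) simp
    ultimately show ?thesis by (simp only:)
  qed
  moreover from this have "dwork_carlitz_exp \<iota> \<sigma> 1 = \<sigma>"
    using limits(1) LIMSEQ_unique by blast
  ultimately show ?thesis
    using \<rho> sums unfolding u_def by blast
qed

end
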